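(* Let $U$ be a subset of $F_{USCG}(\mathbb{R}^m)$. Then $U$ is a relatively compact set in $(F_{USCG}(\mathbb{R}^m),H_{\rm end})$ if and only if $U(\alpha):=\bigcup_{u\in U}[u]_\alpha$ is a bounded set in $\mathbb{R}^m$ for each $\alpha\in(0,1]$.
   Context: A fuzzy set on $\mathbb{R}^m$ is a function $u:\mathbb{R}^m\to[0,1]$. For $\alpha\in(0,1]$, $[u]_\alpha=\{x:u(x)\ge\alpha\}$. $F_{USCG}(\mathbb{R}^m)$ is the set of all upper semi-continuous fuzzy sets $u$ on $\mathbb{R}^m$ with $[u]_\alpha$ bounded for each $\alpha\in(0,1]$ (cuts may be empty). The endograph of $u$ is ${\rm end}\,u=\{(x,t)\in\mathbb{R}^m\times[0,1]:u(x)\ge t\}$, and the endograph metric is $H_{\rm end}(u,v)=H({\rm end}\,u,{\rm end}\,v)$, where $H(A,B)=\max\{\sup_{a\in A}\inf_{b\in B}d(a,b),\ \sup_{b\in B}\inf_{a\in A}d(a,b)\}$ is the Hausdorff metric on nonempty closed sets ($d$ Euclidean). A set is relatively compact in a metric space if its closure in that space is compact. *)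

theory Defs
  imports "HOL-Analysis.Analysis"
begin

text \<open>The values are extended, so that the suprema and infima need no side conditions.\<close>
definition Hausdorff_dist :: "'a::metric_space set \<Rightarrow> 'a set \<Rightarrow> ennreal" where
  "Hausdorff_dist A B =
     max (SUP a\<in>A. INF b\<in>B. ennreal (dist a b)) (SUP b\<in>B. INF a\<in>A. ennreal (dist a b))"

definition upper_semicontinuous :: "('a::topological_space \<Rightarrow> real) \<Rightarrow> bool" where
  "upper_semicontinuous f \<longleftrightarrow> (\<forall>x y. f x < y \<longrightarrow> (\<forall>\<^sub>F z in nhds x. f z < y))"

definition fuzzy_set :: "('a \<Rightarrow> real) \<Rightarrow> bool" where
  "fuzzy_set u \<longleftrightarrow> (\<forall>x. u x \<in> {0..1})"

definition alpha_cut :: "('a \<Rightarrow> real) \<Rightarrow> real \<Rightarrow> 'a set" where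
  "alpha_cut u \<alpha> = {x. u x \<ge> \<alpha>}"

definition endograph :: "('a \<Rightarrow> real) \<Rightarrow> ('a \<times> real) set" where
  "endograph u = {(x, t). t \<in> {0..1} \<and> u x \<ge> t}"

definition F_USCG :: "(real ^ 'm \<Rightarrow> real) set" where
  "F_USCG = {u. fuzzy_set u \<and> upper_semicontinuous u \<and> (\<forall>\<alpha>\<in>{0<..1}. bounded (alpha_cut u \<alpha>))}"

text \<open>The library metric on \<open>(real ^ 'm) \<times> real\<close> is the Euclidean one. The Hausdorff distance
  of two endographs of fuzzy sets is at most 1 (see \<open>Hausdorff_dist_endograph_le_1\<close> below),
  so nothing is lost by the conversion to real numbers.\<close>
definition H_end :: "(real ^ 'm \<Rightarrow> real) \<Rightarrow> (real ^ 'm \<Rightarrow> real) \<Rightarrow> real" where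
  "H_end u v = enn2real (Hausdorff_dist (endograph u) (endograph v))"

lemma INF_ennreal_dist:
  assumes "B \<noteq> {}"
  shows "(INF b\<in>B. ennreal (dist a b)) = ennreal (infdist a B)"
proof (rule antisym)
  show "ennreal (infdist a B) \<le> (INF b\<in>B. ennreal (dist a b))"
    by (intro INF_greatest ennreal_leI infdist_le)
  show "(INF b\<in>B. ennreal (dist a b)) \<le> ennreal (infdist a B)"
  proof (rule ennreal_le_epsilon)
    fix e :: real assume e: "0 < e"
    have "(INF b\<in>B. dist a b) < infdist a B + e"
      using e assms by (simp add: infdist_notempty)
    then obtain b where b: "b \<in> B" "dist a b < infdist a B + e"
      using assms by (subst (asm) cINF_less_iff) auto
    have "(INF b\<in>B. ennreal (dist a b)) \<le> ennreal (dist a b)"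
      using b by (auto intro: INF_lower)
    also have "\<dots> \<le> ennreal (infdist a B + e)"
      using b by (intro ennreal_leI) simp
    also have "\<dots> = ennreal (infdist a B) + ennreal e"
      using e by (simp add: infdist_nonneg)
    finally show "(INF b\<in>B. ennreal (dist a b)) \<le> ennreal (infdist a B) + ennreal e" .
  qed
qed

lemma Hausdorff_dist_le_iff:
  assumes "A \<noteq> {}" "B \<noteq> {}" "0 \<le> r"
  shows "Hausdorff_dist A B \<le> ennreal r \<longleftrightarrow>
    (\<forall>a\<in>A. infdist a B \<le> r) \<and> (\<forall>b\<in>B. infdist b A \<le> r)"
proof -
  have "(INF a\<in>A. ennreal (dist a b)) = ennreal (infdist b A)" for b
    using INF_ennreal_dist [OF assms(1), of b] by (simp add: dist_commute)
  then show ?thesis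
    using assms by (simp add: Hausdorff_dist_def INF_ennreal_dist SUP_le_iff ennreal_le_iff)
qed

lemma Hausdorff_dist_commute: "Hausdorff_dist A B = Hausdorff_dist B A"
  by (simp add: Hausdorff_dist_def dist_commute max.commute)

lemma zero_in_endograph: "fuzzy_set u \<Longrightarrow> (x, 0) \<in> endograph u"
  by (auto simp: endograph_def fuzzy_set_def)

lemma endograph_nonempty: "fuzzy_set u \<Longrightarrow> endograph u \<noteq> {}"
  using zero_in_endograph [of u undefined] by auto

lemma Hausdorff_dist_endograph_le_1:
  fixes u v :: "'a::metric_space \<Rightarrow> real"
  assumes "fuzzy_set u" "fuzzy_set v"
  shows "Hausdorff_dist (endograph u) (endograph v) \<le> 1"
proof -
  have *: "infdist p (endograph w) \<le> 1"
    if "fuzzy_set w" "p \<in> endograph z" for p and w z :: "'a \<Rightarrow> real"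
    by (rule infdist_le2 [OF zero_in_endograph [OF that(1), of "fst p"]])
       (use that(2) in \<open>auto simp: endograph_def dist_Pair_Pair\<close>)
  have "endograph u \<noteq> {}" "endograph v \<noteq> {}"
    using assms by (simp_all add: endograph_nonempty)
  then show ?thesis
    using Hausdorff_dist_le_iff [of "endograph u" "endograph v" 1]
      * [OF assms(1)] * [OF assms(2)] by (metis ennreal_1 zero_le_one)
qed

lemma H_end_le_iff:
  fixes u v :: "real ^ 'm \<Rightarrow> real"
  assumes "fuzzy_set u" "fuzzy_set v" "0 \<le> r"
  shows "H_end u v \<le> r \<longleftrightarrow> (\<forall>p\<in>endograph u. infdist p (endograph v) \<le> r) \<and>
     (\<forall>p\<in>endograph v. infdist p (endograph u) \<le> r)"
proof -
  have ne: "endograph u \<noteq> {}" "endograph v \<noteq> {}"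
    using assms by (simp_all add: endograph_nonempty)
  have "Hausdorff_dist (endograph u) (endograph v) < top"
    using Hausdorff_dist_endograph_le_1 [OF assms(1,2)] by (simp add: le_less_trans)
  then have "ennreal (H_end u v) = Hausdorff_dist (endograph u) (endograph v)"
    by (simp add: H_end_def)
  then have "H_end u v \<le> r \<longleftrightarrow> Hausdorff_dist (endograph u) (endograph v) \<le> ennreal r"
    using assms(3) by (metis ennreal_le_iff)
  then show ?thesis
    using Hausdorff_dist_le_iff [OF ne assms(3)] by simp
qed

lemma closed_endograph:
  fixes u :: "'a::metric_space \<Rightarrow> real"
  assumes "upper_semicontinuous u"
  shows "closed (endograph u)"
proof -
  have "open (- endograph u)"
    unfolding open_prod_def
  proof (intro ballI)
    fix p assume "p \<in> - endograph u"
    then obtain x t where p: "p = (x, t)" and xt: "t \<notin> {0..1} \<or> u x < t"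
      by (cases p) (auto simp: endograph_def)
    show "\<exists>A B. open A \<and> open B \<and> p \<in> A \<times> B \<and> A \<times> B \<subseteq> - endograph u"
    proof (cases "t \<in> {0..1}")
      case False
      then show ?thesis
        by (intro exI [of _ UNIV] exI [of _ "- {0..1}"]) (auto simp: p endograph_def)
    next
      case True
      then obtain s where s: "u x < s" "s < t"
        using xt dense by blast
      then have "\<forall>\<^sub>F z in nhds x. u z < s"
        using assms by (auto simp: upper_semicontinuous_def)
      then obtain A where A: "open A" "x \<in> A" "\<forall>z\<in>A. u z < s"
        by (auto simp: eventually_nhds)
      then have "A \<times> {s<..} \<subseteq> - endograph u"
        by (force simp: endograph_def)
      then show ?thesis
        using A s by (intro exI [of _ A] exI [of _ "{s<..}"]) (auto simp: p)
    qed
  qed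
  then show ?thesis
    by (simp add: closed_def)
qed

lemma endograph_subset_imp_le:
  assumes "fuzzy_set u" "endograph u \<subseteq> endograph v"
  shows "u x \<le> v x"
proof -
  have "(x, u x) \<in> endograph u"
    using assms(1) by (simp add: endograph_def fuzzy_set_def)
  then show ?thesis
    using assms(2) by (auto simp: endograph_def)
qed

interpretation USCG: Metric_space "F_USCG :: (real ^ 'm \<Rightarrow> real) set" H_end
proof
  fix u v :: "real ^ 'm \<Rightarrow> real"
  show "0 \<le> H_end u v"
    by (simp add: H_end_def)
  show "H_end u v = H_end v u"
    by (simp add: H_end_def Hausdorff_dist_commute)
next
  fix u v :: "real ^ 'm \<Rightarrow> real"
  assume "u \<in> F_USCG" "v \<in> F_USCG"
  then have uv: "fuzzy_set u" "fuzzy_set v" "closed (endograph u)" "closed (endograph v)"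
    by (auto simp: F_USCG_def closed_endograph)
  have ne: "endograph u \<noteq> {}" "endograph v \<noteq> {}"
    using uv by (simp_all add: endograph_nonempty)
  have "H_end u v = 0 \<longleftrightarrow> H_end u v \<le> 0"
    by (simp add: H_end_def antisym_conv)
  also have "\<dots> \<longleftrightarrow> endograph u \<subseteq> endograph v \<and> endograph v \<subseteq> endograph u"
  proof -
    have "infdist p A \<le> 0 \<longleftrightarrow> p \<in> A" if "closed A" "A \<noteq> {}" for p and A :: "((real ^ 'm) \<times> real) set"
      using in_closed_iff_infdist_zero [OF that] infdist_nonneg [of p A] by (metis order.antisym order.refl)
    then show ?thesis
      using uv ne by (simp add: H_end_le_iff subset_eq)
  qed
  also have "\<dots> \<longleftrightarrow> u = v"
  proof
    assume "endograph u \<subseteq> endograph v \<and> endograph v \<subseteq> endograph u"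
    then have "u x = v x" for x
      using endograph_subset_imp_le [OF uv(1)] endograph_subset_imp_le [OF uv(2)]
      by (intro antisym) blast+
    then show "u = v" ..
  qed simp
  finally show "H_end u v = 0 \<longleftrightarrow> u = v" .
next
  fix u v w :: "real ^ 'm \<Rightarrow> real"
  assume "u \<in> F_USCG" "v \<in> F_USCG" "w \<in> F_USCG"
  then have fz: "fuzzy_set u" "fuzzy_set v" "fuzzy_set w"
    by (auto simp: F_USCG_def)
  have nn: "0 \<le> H_end a b" for a b :: "real ^ 'm \<Rightarrow> real"
    by (simp add: H_end_def)
  have *: "infdist p (endograph c) \<le> H_end a b + H_end b c"
    if "fuzzy_set a" "fuzzy_set b" "fuzzy_set c" "p \<in> endograph a"
    for a b c :: "real ^ 'm \<Rightarrow> real" and p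
  proof -
    have ne: "endograph b \<noteq> {}"
      using that by (simp add: endograph_nonempty)
    have "infdist p (endograph c) - H_end b c \<le> dist p q" if "q \<in> endograph b" for q
    proof -
      have "infdist q (endograph c) \<le> H_end b c"
        using H_end_le_iff [OF \<open>fuzzy_set b\<close> \<open>fuzzy_set c\<close> nn] that by blast
      then show ?thesis
        using infdist_triangle [of p "endograph c" q] by linarith
    qed
    then have "infdist p (endograph c) - H_end b c \<le> infdist p (endograph b)"
      using ne by (simp add: infdist_notempty cINF_greatest)
    also have "\<dots> \<le> H_end a b"
      using H_end_le_iff [OF \<open>fuzzy_set a\<close> \<open>fuzzy_set b\<close> nn] that by blast
    finally show ?thesis by simp
  qed
  have comm: "H_end a b = H_end b a" for a b :: "real ^ 'm \<Rightarrow> real"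
    by (simp add: H_end_def Hausdorff_dist_commute)
  show "H_end u w \<le> H_end u v + H_end v w"
  proof (subst H_end_le_iff [OF fz(1,3) add_nonneg_nonneg [OF nn nn]], intro conjI ballI)
    fix p
    show "infdist p (endograph w) \<le> H_end u v + H_end v w" if "p \<in> endograph u"
      using * [OF fz that] .
    show "infdist p (endograph u) \<le> H_end u v + H_end v w" if "p \<in> endograph w"
      using * [OF fz(3,2,1) that] comm [of w v] comm [of v u] by linarith
  qed
qed

end

theory Submission
  imports Defs
begin

text \<open>
  Relative compactness is total boundedness once the space is complete, so the theorem
  splits into completeness of \<open>F_USCG\<close> (\<open>mcomplete_F_USCG\<close>) and the equivalence of total
  boundedness with uniform boundedness of the cuts (\<open>totally_bounded_iff_bounded_cuts\<close>).

  All boundedness claims about cuts rest on one observation (\<open>alpha_cut_subset_thickening\<close>):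
  a point \<open>(x, \<alpha>)\<close> of one endograph that lies within \<open>\<alpha> - \<beta>\<close> of another endograph is close to
  a point of height at least \<open>\<beta>\<close>, so the \<open>\<alpha>\<close>-cut of the first function is contained in a
  thickening of the \<open>\<beta>\<close>-cut of the second. Hence a finite net bounds the cuts of a whole
  family, and a limit of functions with bounded cuts has bounded cuts.

  For the converse, the part of an endograph at height at most \<open>e\<close> is within \<open>e\<close> of every
  other endograph, because all endographs contain the whole level zero. Only the part above
  height \<open>e\<close> matters, and uniformly bounded cuts confine it to one bounded region of
  \<open>real ^ 'm \<times> {0..1}\<close>. A finite \<open>e\<close>-net of this region then determines an endograph
  up to \<open>2 * e\<close> by recording which points of the net are close to it, and there are only
  finitely many such records.

  For completeness, the limit of a Cauchy sequence is built from the set of cluster points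
  of its endographs, which is again an endograph (\<open>ex_fuzzy_set_endograph\<close>). The Heine-Borel
  property of \<open>real ^ 'm \<times> real\<close> supplies enough cluster points.
\<close>

section \<open>Endographs and cuts\<close>

lemma endograph_downward_closed:
  "\<lbrakk>(x, t) \<in> endograph u; 0 \<le> s; s \<le> t\<rbrakk> \<Longrightarrow> (x, s) \<in> endograph u"
  by (auto simp: endograph_def)

lemma upper_semicontinuous_if_closed_endograph:
  fixes u :: "'a::metric_space \<Rightarrow> real"
  assumes "fuzzy_set u" "closed (endograph u)"
  shows "upper_semicontinuous u"
  unfolding upper_semicontinuous_def
proof (intro allI impI)
  fix x and y :: real
  assume less: "u x < y"
  have u01: "0 \<le> u z" "u z \<le> 1" for z
    using assms(1) by (auto simp: fuzzy_set_def)
  show "\<forall>\<^sub>F z in nhds x. u z < y"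
  proof (cases "y \<le> 1")
    case False
    then have "u z < y" for z
      using u01(2)[of z] by linarith
    then show ?thesis
      by simp
  next
    case True
    have y: "0 < y"
      using less u01(1)[of x] by linarith
    have "open (- endograph u)"
      using assms(2) by (simp add: closed_def)
    moreover have "(x, y) \<in> - endograph u"
      using less by (simp add: endograph_def)
    ultimately obtain A B where AB: "open A" "x \<in> A" "y \<in> B" "A \<times> B \<subseteq> - endograph u"
      by (rule open_prod_elim) auto
    have "u z < y" if "z \<in> A" for z
    proof -
      have "(z, y) \<notin> endograph u"
        using AB that by blast
      then show ?thesis
        using True y by (auto simp: endograph_def)
    qed
    then show ?thesis
      using AB(1,2) by (auto simp: eventually_nhds)
  qed
qed

text \<open>The function is recovered from its endograph as \<open>x \<mapsto> Sup {t. (x, t) \<in> E}\<close>; closedness of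
  \<open>E\<close> makes this supremum attained, so that no point is added.\<close>
lemma ex_fuzzy_set_endograph:
  fixes E :: "('a::metric_space \<times> real) set"
  assumes "closed E" "E \<subseteq> UNIV \<times> {0..1}" "\<And>x. (x, 0) \<in> E"
    and down: "\<And>x s t. \<lbrakk>(x, t) \<in> E; 0 \<le> s; s \<le> t\<rbrakk> \<Longrightarrow> (x, s) \<in> E"
  shows "\<exists>u. fuzzy_set u \<and> upper_semicontinuous u \<and> endograph u = E"
proof -
  define u where "u x = Sup {t. (x, t) \<in> E}" for x
  have bdd: "bdd_above {t. (x, t) \<in> E}" for x
    using assms(2) by (intro bdd_aboveI[of _ 1]) auto
  have attained: "(x, u x) \<in> E" for x
  proof -
    have "closed {t. (x, t) \<in> E}"
      using continuous_closed_vimage[OF assms(1), of "\<lambda>t. (x, t)"]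
      by (simp add: vimage_def continuous_Pair)
    then show ?thesis
      using closed_contains_Sup[OF _ bdd] assms(3)[of x] by (auto simp: u_def)
  qed
  have iff: "(x, t) \<in> E \<longleftrightarrow> 0 \<le> t \<and> t \<le> u x" for x t
  proof
    assume "(x, t) \<in> E"
    then show "0 \<le> t \<and> t \<le> u x"
      using subsetD[OF assms(2)] cSup_upper[OF _ bdd, of t x] by (fastforce simp: u_def)
  next
    assume "0 \<le> t \<and> t \<le> u x"
    then show "(x, t) \<in> E"
      using down[OF attained] by simp
  qed
  have fuzzy: "fuzzy_set u"
    unfolding fuzzy_set_def using subsetD[OF assms(2) attained] by simp
  have "endograph u = E"
  proof (rule set_eqI)
    fix p :: "'a \<times> real"
    have "u (fst p) \<le> 1"
      using fuzzy by (simp add: fuzzy_set_def)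
    then show "p \<in> endograph u \<longleftrightarrow> p \<in> E"
      by (cases p) (auto simp: endograph_def iff)
  qed
  with fuzzy show ?thesis
    using assms(1) upper_semicontinuous_if_closed_endograph[OF fuzzy] by auto
qed

text \<open>The infimum distance to \<open>endograph v\<close> is attained because upper semicontinuity of \<open>v\<close> makes
  this endograph closed.\<close>
lemma ex_endograph_within_H_end:
  fixes u v :: "real ^ 'm \<Rightarrow> real"
  assumes "fuzzy_set u" "v \<in> F_USCG" "H_end u v \<le> e" "p \<in> endograph u"
  shows "\<exists>q\<in>endograph v. dist p q \<le> e"
proof -
  have v: "fuzzy_set v" "closed (endograph v)"
    using assms(2) by (auto simp: F_USCG_def closed_endograph)
  have "0 \<le> H_end u v"
    by (simp add: H_end_def)
  then have "infdist p (endograph v) \<le> H_end u v"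
    using H_end_le_iff[OF assms(1) v(1), of "H_end u v"] assms(4) by simp
  moreover obtain q where "q \<in> endograph v" "infdist p (endograph v) = dist p q"
    using infdist_attains_inf[OF v(2) endograph_nonempty[OF v(1)]] .
  ultimately show ?thesis
    using assms(3) by (intro bexI[of _ q]) auto
qed

text \<open>The point of \<open>endograph v\<close> closest to \<open>(x, \<alpha>)\<close> differs from it by at most \<open>\<alpha> - \<beta>\<close> in each
  of the two components. Only \<open>v\<close> is assumed to lie in \<open>F_USCG\<close>, so that the lemma
  applies to a limit \<open>u\<close> whose cuts are not yet known to be bounded.\<close>
lemma alpha_cut_subset_thickening:
  fixes u v :: "real ^ 'm \<Rightarrow> real"
  assumes "fuzzy_set u" "v \<in> F_USCG" "H_end u v \<le> \<alpha> - \<beta>" "\<alpha> \<in> {0..1}"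
  shows "alpha_cut u \<alpha> \<subseteq> (\<Union>y\<in>alpha_cut v \<beta>. cball y (\<alpha> - \<beta>))"
proof
  fix x assume "x \<in> alpha_cut u \<alpha>"
  then have "(x, \<alpha>) \<in> endograph u"
    using assms(4) by (simp add: alpha_cut_def endograph_def)
  then obtain y s where ys: "(y, s) \<in> endograph v" "dist (x, \<alpha>) (y, s) \<le> \<alpha> - \<beta>"
    using ex_endograph_within_H_end[OF assms(1-3)] by (metis surj_pair)
  have "dist x y \<le> \<alpha> - \<beta>" "dist \<alpha> s \<le> \<alpha> - \<beta>"
    using ys(2) dist_fst_le[of "(x, \<alpha>)" "(y, s)"] dist_snd_le[of "(x, \<alpha>)" "(y, s)"] by auto
  then have "y \<in> alpha_cut v \<beta>" "x \<in> cball y (\<alpha> - \<beta>)"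
    using ys(1) by (auto simp: endograph_def alpha_cut_def dist_real_def dist_commute)
  then show "x \<in> (\<Union>y\<in>alpha_cut v \<beta>. cball y (\<alpha> - \<beta>))"
    by blast
qed

lemma bounded_UN_cball:
  fixes S :: "'a::metric_space set"
  assumes "bounded S"
  shows "bounded (\<Union>y\<in>S. cball y r)"
proof -
  obtain a e where ae: "\<forall>y\<in>S. dist a y \<le> e"
    using assms bounded_def by blast
  have "cball y r \<subseteq> cball a (e + r)" if "y \<in> S" for y
  proof
    fix z assume "z \<in> cball y r"
    then show "z \<in> cball a (e + r)"
      using ae that dist_triangle[of a z y] by fastforce
  qed
  then have "(\<Union>y\<in>S. cball y r) \<subseteq> cball a (e + r)"
    by blast
  then show ?thesis
    using bounded_cball bounded_subset by blast
qed

text \<open>The net \<open>K\<close> need not come from \<open>U\<close>. Besides nets of totally bounded families, this covers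
  a single limit function approximated by one member of the sequence.\<close>
lemma bounded_Union_alpha_cut_if_finite_net:
  fixes U :: "(real ^ 'm \<Rightarrow> real) set"
  assumes "\<forall>u\<in>U. fuzzy_set u" "finite K" "K \<subseteq> F_USCG" "\<alpha> \<in> {0<..1}"
    and net: "\<forall>u\<in>U. \<exists>v\<in>K. H_end u v \<le> \<alpha> / 2"
  shows "bounded (\<Union>u\<in>U. alpha_cut u \<alpha>)"
proof (rule bounded_subset)
  have "bounded (alpha_cut v (\<alpha> / 2))" if "v \<in> K" for v
    using that assms(3,4) by (auto simp: F_USCG_def)
  then show "bounded (\<Union>v\<in>K. \<Union>y\<in>alpha_cut v (\<alpha> / 2). cball y (\<alpha> / 2))"
    using assms(2) by (intro bounded_UN ballI bounded_UN_cball)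
  have "alpha_cut u \<alpha> \<subseteq> (\<Union>v\<in>K. \<Union>y\<in>alpha_cut v (\<alpha> / 2). cball y (\<alpha> / 2))" if "u \<in> U" for u
  proof -
    obtain v where v: "v \<in> K" "H_end u v \<le> \<alpha> / 2"
      using net \<open>u \<in> U\<close> by blast
    then have "alpha_cut u \<alpha> \<subseteq> (\<Union>y\<in>alpha_cut v (\<alpha> / 2). cball y (\<alpha> / 2))"
      using alpha_cut_subset_thickening[of u v \<alpha> "\<alpha> / 2"] assms(1,3,4) \<open>u \<in> U\<close> by auto
    with v(1) show ?thesis
      by blast
  qed
  then show "(\<Union>u\<in>U. alpha_cut u \<alpha>) \<subseteq> (\<Union>v\<in>K. \<Union>y\<in>alpha_cut v (\<alpha> / 2). cball y (\<alpha> / 2))"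
    by blast
qed

section \<open>Completeness\<close>

text \<open>The intersection is the upper Kuratowski limit of the sequence \<open>A\<close>. For a Cauchy sequence
  it is the limit in the Hausdorff distance: each point \<open>p\<close> of \<open>A n\<close> has a companion within
  \<open>e\<close> in every set from index \<open>N\<close> on. These companions form a bounded sequence, and any of its
  cluster points lies in the limit and is within \<open>e\<close> of \<open>p\<close>.\<close>
lemma infdist_upper_limit_le:
  fixes A :: "nat \<Rightarrow> 'a::heine_borel set"
  assumes near: "\<forall>m\<ge>N. \<forall>n\<ge>N. \<forall>p\<in>A m. \<exists>q\<in>A n. dist p q \<le> e"
    and "N \<le> n"
  defines "E \<equiv> (\<Inter>M. closure (\<Union>k\<in>{M..}. A k))"
  shows "p \<in> E \<Longrightarrow> infdist p (A n) \<le> e" and "p \<in> A n \<Longrightarrow> \<exists>q\<in>E. dist p q \<le> e"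
proof -
  assume "p \<in> E"
  then have "p \<in> closure (\<Union>k\<in>{N..}. A k)"
    by (auto simp: E_def)
  moreover have "closure (\<Union>k\<in>{N..}. A k) \<subseteq> {q. infdist q (A n) \<le> e}"
  proof (rule closure_minimal)
    show "closed {q. infdist q (A n) \<le> e}"
      by (intro closed_Collect_le continuous_intros)
    show "(\<Union>k\<in>{N..}. A k) \<subseteq> {q. infdist q (A n) \<le> e}"
      using near \<open>N \<le> n\<close> by (fastforce intro: infdist_le2)
  qed
  ultimately show "infdist p (A n) \<le> e"
    by blast
next
  assume "p \<in> A n"
  then have "\<forall>k. \<exists>q\<in>A (k + N). dist p q \<le> e"
    using near \<open>N \<le> n\<close> by simp
  then obtain q where q: "\<And>k. q k \<in> A (k + N)" "\<And>k. dist p (q k) \<le> e"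
    by metis
  have "bounded (range q)"
    using q(2) by (auto simp: bounded_def)
  then obtain l r where r: "strict_mono (r :: nat \<Rightarrow> nat)" and l: "(q \<circ> r) \<longlonglongrightarrow> l"
    using bounded_imp_convergent_subsequence by blast
  have "l \<in> closure (\<Union>k\<in>{M..}. A k)" for M
  proof (rule Lim_in_closed_set[OF closed_closure _ _ l])
    have "(q \<circ> r) k \<in> closure (\<Union>k\<in>{M..}. A k)" if "M \<le> k" for k
    proof -
      have "M \<le> r k + N"
        using that seq_suble[OF r, of k] by linarith
      then show ?thesis
        using q(1)[of "r k"] by (intro subsetD[OF closure_subset]) auto
    qed
    then show "\<forall>\<^sub>F k in sequentially. (q \<circ> r) k \<in> closure (\<Union>k\<in>{M..}. A k)"
      by (auto simp: eventually_sequentially)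
  qed simp
  moreover have "dist p l \<le> e"
    by (rule Lim_bounded[OF tendsto_dist[OF tendsto_const l], of 0]) (simp add: q(2))
  ultimately show "\<exists>q\<in>E. dist p q \<le> e"
    by (auto simp: E_def)
qed

text \<open>The upper limit is downward closed in the height: if points of endographs converge to
  \<open>(x, t)\<close>, then capping their heights at \<open>s \<le> t\<close> keeps them in the endographs and makes them
  converge to \<open>(x, s)\<close>.\<close>
lemma ex_endograph_upper_limit:
  fixes \<sigma> :: "nat \<Rightarrow> 'a::metric_space \<Rightarrow> real"
  assumes "\<And>n. fuzzy_set (\<sigma> n)"
  shows "\<exists>u. fuzzy_set u \<and> upper_semicontinuous u \<and>
    endograph u = (\<Inter>M. closure (\<Union>k\<in>{M..}. endograph (\<sigma> k)))"
proof (rule ex_fuzzy_set_endograph)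
  let ?V = "\<lambda>M. \<Union>k\<in>{M..}. endograph (\<sigma> k)"
  show "closed (\<Inter>M. closure (?V M))"
    by blast
  have "closure (?V 0) \<subseteq> UNIV \<times> {0..1}"
    by (rule closure_minimal) (auto simp: endograph_def intro: closed_Times)
  then show "(\<Inter>M. closure (?V M)) \<subseteq> UNIV \<times> {0..1}"
    by blast
  show "(x, 0) \<in> (\<Inter>M. closure (?V M))" for x
    using zero_in_endograph[OF assms] by (blast intro: subsetD[OF closure_subset])
  fix x s t
  assume xt: "(x, t) \<in> (\<Inter>M. closure (?V M))" and s: "0 \<le> s" "s \<le> t"
  have "(x, s) \<in> closure (?V M)" for M
  proof -
    have "(x, t) \<in> closure (?V M)"
      using xt by blast
    then obtain f where f: "\<And>n. f n \<in> ?V M" "f \<longlonglongrightarrow> (x, t)"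
      by (auto simp: closure_sequential)
    have "(fst (f n), min s (snd (f n))) \<in> ?V M" for n
    proof -
      obtain k where "k \<ge> M" "f n \<in> endograph (\<sigma> k)"
        using f(1)[of n] by blast
      moreover have "0 \<le> min s (snd (f n))"
        using calculation s by (auto simp: endograph_def)
      ultimately have "(fst (f n), min s (snd (f n))) \<in> endograph (\<sigma> k)"
        using endograph_downward_closed[of "fst (f n)" "snd (f n)" "\<sigma> k"] by simp
      with \<open>k \<ge> M\<close> show ?thesis
        by blast
    qed
    moreover have "(\<lambda>n. (fst (f n), min s (snd (f n)))) \<longlonglongrightarrow> (x, min s t)"
      using tendsto_fst[OF f(2)] tendsto_snd[OF f(2)] by (auto intro!: tendsto_intros)
    ultimately have "(x, min s t) \<in> closure (?V M)"
      unfolding closure_sequential by (intro exI conjI allI)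
    then show ?thesis
      using s by simp
  qed
  then show "(x, s) \<in> (\<Inter>M. closure (?V M))"
    by blast
qed

lemma mcomplete_F_USCG:
  "Metric_space.mcomplete (F_USCG :: (real ^ 'm \<Rightarrow> real) set) H_end"
  unfolding USCG.mcomplete_def
proof (intro allI impI)
  fix \<sigma> :: "nat \<Rightarrow> real ^ 'm \<Rightarrow> real"
  assume cauchy: "USCG.MCauchy \<sigma>"
  then have \<sigma>: "\<sigma> n \<in> F_USCG" for n
    by (auto simp: USCG.MCauchy_def)
  then have fuzzy: "fuzzy_set (\<sigma> n)" for n
    by (simp add: F_USCG_def)
  let ?E = "\<Inter>M. closure (\<Union>k\<in>{M..}. endograph (\<sigma> k))"
  obtain u where u: "fuzzy_set u" "upper_semicontinuous u" and end_u: "endograph u = ?E"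
    using ex_endograph_upper_limit[of \<sigma>] fuzzy by metis
  have close: "\<exists>N. \<forall>n\<ge>N. H_end u (\<sigma> n) \<le> e" if "0 < e" for e
  proof -
    obtain N where N: "\<And>m n. \<lbrakk>N \<le> m; N \<le> n\<rbrakk> \<Longrightarrow> H_end (\<sigma> m) (\<sigma> n) < e"
      using cauchy \<open>0 < e\<close> unfolding USCG.MCauchy_def by blast
    have near: "\<forall>m\<ge>N. \<forall>n\<ge>N. \<forall>p\<in>endograph (\<sigma> m). \<exists>q\<in>endograph (\<sigma> n). dist p q \<le> e"
      using ex_endograph_within_H_end[OF fuzzy \<sigma> less_imp_le[OF N]] by simp
    have "H_end u (\<sigma> n) \<le> e" if "N \<le> n" for n
    proof -
      have "infdist p (endograph (\<sigma> n)) \<le> e" if "p \<in> endograph u" for p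
        using infdist_upper_limit_le(1)[OF near \<open>N \<le> n\<close>] that by (simp add: end_u)
      moreover have "infdist p (endograph u) \<le> e" if p: "p \<in> endograph (\<sigma> n)" for p
      proof -
        obtain q where "q \<in> endograph u" "dist p q \<le> e"
          using infdist_upper_limit_le(2)[OF near \<open>N \<le> n\<close> p] unfolding end_u by (rule bexE)
        then show ?thesis
          by (rule infdist_le2)
      qed
      ultimately show ?thesis
        using u(1) fuzzy \<open>0 < e\<close> by (subst H_end_le_iff) auto
    qed
    then show ?thesis
      by blast
  qed
  have "bounded (alpha_cut u \<alpha>)" if "\<alpha> \<in> {0<..1}" for \<alpha>
  proof -
    obtain N where "H_end u (\<sigma> N) \<le> \<alpha> / 2"
      using close[of "\<alpha> / 2"] \<open>\<alpha> \<in> {0<..1}\<close> by auto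
    then show ?thesis
      using bounded_Union_alpha_cut_if_finite_net[of "{u}" "{\<sigma> N}" \<alpha>] u(1) \<sigma> that by simp
  qed
  then have "u \<in> F_USCG"
    using u by (simp add: F_USCG_def)
  moreover have "\<exists>N. \<forall>n\<ge>N. H_end (\<sigma> n) u < e" if "0 < e" for e
  proof -
    obtain N where "\<forall>n\<ge>N. H_end u (\<sigma> n) \<le> e / 2"
      using close[of "e / 2"] \<open>0 < e\<close> by auto
    then have "\<forall>n\<ge>N. H_end (\<sigma> n) u < e"
      using \<open>0 < e\<close> by (force simp: USCG.commute)
    then show ?thesis
      by blast
  qed
  ultimately show "\<exists>u. limitin USCG.mtopology \<sigma> u sequentially"
    using \<sigma> by (auto simp: USCG.limit_metric_sequentially)
qed

section \<open>Total boundedness\<close>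

text \<open>A point of one endograph at height at most \<open>e\<close> is close to the level zero of the other.
  A higher one reaches the other endograph in two steps of length \<open>e\<close>, via a point of the
  net \<open>F\<close> that is near both endographs.\<close>
lemma H_end_le_if_same_net_points:
  fixes u v :: "real ^ 'm \<Rightarrow> real"
  assumes "fuzzy_set u" "fuzzy_set v" "0 \<le> e"
    and cover: "\<And>x t. \<lbrakk>(x, t) \<in> endograph u \<union> endograph v; e < t\<rbrakk> \<Longrightarrow> \<exists>f\<in>F. dist (x, t) f \<le> e"
    and same: "\<And>f. f \<in> F \<Longrightarrow> infdist f (endograph u) \<le> e \<longleftrightarrow> infdist f (endograph v) \<le> e"
  shows "H_end u v \<le> 2 * e"
proof -
  have *: "infdist p (endograph b) \<le> 2 * e"
    if "fuzzy_set b" and p: "p \<in> endograph a" "p \<in> endograph u \<union> endograph v"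
      and same: "\<And>f. \<lbrakk>f \<in> F; infdist f (endograph a) \<le> e\<rbrakk> \<Longrightarrow> infdist f (endograph b) \<le> e"
    for a b :: "real ^ 'm \<Rightarrow> real" and p
  proof (cases "snd p \<le> e")
    case True
    then have "dist p (fst p, 0) \<le> e"
      using p(1) by (cases p) (auto simp: dist_Pair_Pair endograph_def)
    then show ?thesis
      using infdist_le2[OF zero_in_endograph[OF \<open>fuzzy_set b\<close>], of p "fst p" e] \<open>0 \<le> e\<close> by simp
  next
    case False
    then obtain f where f: "f \<in> F" "dist p f \<le> e"
      using cover[of "fst p" "snd p"] p(2) by auto
    then have "infdist f (endograph a) \<le> e"
      using p(1) by (metis dist_commute infdist_le2)
    then have "infdist f (endograph b) \<le> e"
      using same f(1) by blast
    then show ?thesis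
      using infdist_triangle[of p "endograph b" f] f(2) by simp
  qed
  have "0 \<le> 2 * e"
    using assms(3) by simp
  then show ?thesis
  proof (subst H_end_le_iff[OF assms(1,2)], assumption, intro conjI ballI)
    show "infdist p (endograph v) \<le> 2 * e" if "p \<in> endograph u" for p
      using that same by (intro *[OF assms(2) that]) auto
    show "infdist p (endograph u) \<le> 2 * e" if "p \<in> endograph v" for p
      using that same by (intro *[OF assms(1) that]) auto
  qed
qed

text \<open>From left to right, a finite \<open>\<alpha> / 2\<close>-net of \<open>U\<close> bounds all \<open>\<alpha>\<close>-cuts at once. From right to
  left, the net is obtained by choosing one function for each subset of the finite point set \<open>F\<close>
  that arises as the set of points close to an endograph.\<close>
lemma totally_bounded_iff_bounded_cuts:
  fixes U :: "(real ^ 'm \<Rightarrow> real) set"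
  assumes "U \<subseteq> F_USCG"
  shows "USCG.mtotally_bounded U \<longleftrightarrow> (\<forall>\<alpha>\<in>{0<..1}. bounded (\<Union>u\<in>U. alpha_cut u \<alpha>))"
    (is "?L \<longleftrightarrow> ?R")
proof
  assume ?L
  show ?R
  proof
    fix \<alpha> :: real assume \<alpha>: "\<alpha> \<in> {0<..1}"
    then obtain K where K: "finite K" "K \<subseteq> U" "U \<subseteq> (\<Union>v\<in>K. USCG.mball v (\<alpha> / 2))"
      using \<open>?L\<close> unfolding USCG.mtotally_bounded_def by (metis greaterThanAtMost_iff half_gt_zero)
    have "\<exists>v\<in>K. H_end u v \<le> \<alpha> / 2" if u: "u \<in> U" for u
    proof -
      obtain v where "v \<in> K" "u \<in> USCG.mball v (\<alpha> / 2)"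
        using K(3) u by blast
      then show ?thesis
        by (intro bexI[of _ v]) (simp_all add: USCG.commute)
    qed
    then show "bounded (\<Union>u\<in>U. alpha_cut u \<alpha>)"
      using K \<alpha> assms
      by (intro bounded_Union_alpha_cut_if_finite_net[of U K]) (auto simp: F_USCG_def)
  qed
next
  assume bdd: ?R
  show ?L
    unfolding USCG.mtotally_bounded_def
  proof (intro allI impI)
    fix \<epsilon> :: real assume "0 < \<epsilon>"
    \<comment> \<open>Below \<open>\<epsilon> / 2\<close> because a net of mesh \<open>e\<close> controls \<open>H_end\<close> up to \<open>2 * e\<close>, and at most 1 so
      that the \<open>e\<close>-cuts are among those assumed to be bounded.\<close>
    define e where "e = min 1 (\<epsilon> / 3)"
    have e: "0 < e" "e \<le> 1" "2 * e < \<epsilon>"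
      using \<open>0 < \<epsilon>\<close> by (auto simp: e_def)
    define S where "S = (\<Union>u\<in>U. alpha_cut u e) \<times> {0..1::real}"
    have "bounded S"
      unfolding S_def using bdd e by (intro bounded_Times) auto
    then have "seq_compact (closure S)"
      by (simp add: compact_imp_seq_compact compact_closure)
    then obtain F where F: "finite F" "closure S \<subseteq> (\<Union>f\<in>F. ball f e)"
      using seq_compact_imp_totally_bounded e(1) by metis
    define near where "near u = {f \<in> F. infdist f (endograph u) \<le> e}" for u
    have "finite (near ` U)"
      using F(1) by (intro finite_subset[of "near ` U" "Pow F"]) (auto simp: near_def)
    then obtain K where K: "K \<subseteq> U" "finite K" "near ` U = near ` K"
      by (metis finite_subset_image order_refl)
    have "U \<subseteq> (\<Union>v\<in>K. USCG.mball v \<epsilon>)"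
    proof
      fix u assume u: "u \<in> U"
      then obtain v where v: "v \<in> K" "near u = near v"
        using K(3) by (metis image_eqI imageE)
      have "\<exists>f\<in>F. dist (x, t) f \<le> e"
        if xt: "(x, t) \<in> endograph u \<union> endograph v" "e < t" for x t
      proof -
        obtain w where "w \<in> U" "(x, t) \<in> endograph w"
          using xt(1) u subsetD[OF K(1) v(1)] by auto
        then have "w \<in> U" "x \<in> alpha_cut w e" "t \<in> {0..1}"
          using \<open>e < t\<close> by (auto simp: endograph_def alpha_cut_def)
        then have "(x, t) \<in> S"
          unfolding S_def by auto
        then have "(x, t) \<in> (\<Union>f\<in>F. ball f e)"
          using F(2) closure_subset[of S] by (meson subsetD)
        then obtain f where "f \<in> F" "(x, t) \<in> ball f e"
          by (rule UN_E)
        then show ?thesis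
          by (intro bexI[of _ f]) (simp_all add: dist_commute)
      qed
      moreover have "infdist f (endograph u) \<le> e \<longleftrightarrow> infdist f (endograph v) \<le> e" if "f \<in> F" for f
        using v(2) that by (auto simp: near_def)
      moreover have "u \<in> F_USCG" "v \<in> F_USCG"
        using u v(1) K(1) assms by auto
      ultimately have "H_end u v \<le> 2 * e"
        using e(1) by (intro H_end_le_if_same_net_points[of u v e F]) (auto simp: F_USCG_def)
      then have "u \<in> USCG.mball v \<epsilon>"
        using \<open>u \<in> F_USCG\<close> \<open>v \<in> F_USCG\<close> e(3) by (simp add: USCG.commute)
      then show "u \<in> (\<Union>v\<in>K. USCG.mball v \<epsilon>)"
        using v(1) by blast
    qed
    with K show "\<exists>K. finite K \<and> K \<subseteq> U \<and> U \<subseteq> (\<Union>x\<in>K. USCG.mball x \<epsilon>)"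
      by blast
  qed
qed

section \<open>Relative compactness\<close>

theorem theorem7p1:
  fixes U :: "(real ^ 'm \<Rightarrow> real) set"
  assumes "U \<subseteq> F_USCG"
  shows "compactin USCG.mtopology (USCG.mtopology closure_of U) \<longleftrightarrow>
    (\<forall>\<alpha>\<in>{0<..1}. bounded (\<Union>u\<in>U. alpha_cut u \<alpha>))"
  using assms totally_bounded_iff_bounded_cuts[OF assms]
    USCG.mtotally_bounded_eq_compact_closure_of[OF mcomplete_F_USCG, of U] by simp

end
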